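(* There is a unique family of homogeneous polynomials $\{\mathfrak{P}_F(\mathbf{x};\mathbf{t}) : F \text{ an indexed forest}\}\subset \mathbb{Z}[\mathbf{t}][\mathbf{x}]$ such that, writing $\widehat{\mathbf{t}}_i=(t_1,\dots,t_{i-1},t_{i+1},t_{i+2},\dots)$, for every indexed forest $F$ we have $$\mathfrak{P}_F(\mathbf{t};\mathbf{t})=\begin{cases}1 & F=\emptyset\\ 0 & \text{otherwise,}\end{cases}\qquad\text{and for every } i\ge 1:\qquad E_i\mathfrak{P}_F=\begin{cases}\mathfrak{P}_{F/i}(\mathbf{x};\widehat{\mathbf{t}}_i) & i\in \mathrm{Qdes}(F)\\ 0 & \text{otherwise.}\end{cases}$$
   Context: $\mathbf{x}=(x_1,x_2,\dots)$ and $\mathbf{t}=(t_1,t_2,\dots)$ are two infinite sets of commuting variables; homogeneity is with respect to total degree with $\deg x_i=\deg t_i=1$. $\mathfrak{P}_F(\mathbf{t};\mathbf{t})$ means substituting $x_i=t_i$ for all $i$, and $\mathfrak P_{F/i}(\mathbf x;\widehat{\mathbf t}_i)$ means substituting the sequence $\widehat{\mathbf t}_i$ for the sequence $\mathbf t$. For $f\in\mathbb Z[\mathbf t][\mathbf x]$ set $R_i^-f=f(x_1,\dots,x_{i-1},t_i,x_i,x_{i+1},\dots;\mathbf t)$, $R_i^+f=f(x_1,\dots,x_{i-1},x_i,t_i,x_{i+1},\dots;\mathbf t)$ (insert $t_i$ in position $i$, resp. $i+1$, shifting later $x$'s up), and $E_if=(R_i^+f-R_i^-f)/(x_i-t_i)$.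 Indexed forests: a binary plane tree is a rooted tree in which each node is either a leaf or an internal node with an ordered pair of children (left child, right child); the one-node tree is trivial. An indexed forest is a sequence $F=(T_1,T_2,\dots)$ of binary plane trees, all but finitely many trivial. The leaves of $F$ are identified with $\mathbb N=\{1,2,\dots\}$ from left to right across all trees in order. $\emptyset$ is the forest with all trees trivial. An internal node is terminal if both its children are leaves. For an internal node $v$, $\rho_F(v)$ is the leaf reached from $v$ by repeatedly passing to the left child. $\mathrm{Qdes}(F)=\{\rho_F(v): v\text{ terminal}\}$. For $i\in\mathrm{Qdes}(F)$, $F/i$ is the indexed forest obtained by deleting the terminal node $v$ with $\rho_F(v)=i$ (replacing $v$ and its two leaves by a single leaf, and relabeling leaves left to right by $\mathbb N$). *)

theory Defs
  imports Main "HOL-Library.Poly_Mapping"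
begin

text \<open>Indices are 0-based: X n stands for x_(n+1), T n for t_(n+1).\<close>
datatype var = X nat | T nat

type_synonym poly = "((var \<Rightarrow>\<^sub>0 nat) \<Rightarrow>\<^sub>0 int)"

definition Var :: "var \<Rightarrow> poly" where
  "Var v = Poly_Mapping.single (Poly_Mapping.single v 1) 1"

definition homogeneous :: "poly \<Rightarrow> bool" where
  "homogeneous p \<longleftrightarrow> (\<exists>d. \<forall>m\<in>Poly_Mapping.keys p. sum (Poly_Mapping.lookup m) (Poly_Mapping.keys m) = d)"

definition subst :: "(var \<Rightarrow> poly) \<Rightarrow> poly \<Rightarrow> poly" where
  "subst \<sigma> p = (\<Sum>m\<in>Poly_Mapping.keys p. of_int (Poly_Mapping.lookup p m) * (\<Prod>v\<in>Poly_Mapping.keys m. \<sigma> v ^ Poly_Mapping.lookup m v))"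

definition at_t :: "var \<Rightarrow> poly" where
  "at_t v = (case v of X j \<Rightarrow> Var (T j) | T j \<Rightarrow> Var (T j))"

definition hat_t :: "nat \<Rightarrow> var \<Rightarrow> poly" where
  "hat_t i v = (case v of X j \<Rightarrow> Var (X j)
                 | T j \<Rightarrow> (if j < i then Var (T j) else Var (T (Suc j))))"

definition Rminus_sub :: "nat \<Rightarrow> var \<Rightarrow> poly" where
  "Rminus_sub i v = (case v of
      X j \<Rightarrow> (if j < i then Var (X j) else if j = i then Var (T i) else Var (X (j - 1)))
    | T j \<Rightarrow> Var (T j))"

definition Rplus_sub :: "nat \<Rightarrow> var \<Rightarrow> poly" where
  "Rplus_sub i v = (case v of
      X j \<Rightarrow> (if j \<le> i then Var (X j) else if j = Suc i then Var (T i) else Var (X (j - 1)))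
    | T j \<Rightarrow> Var (T j))"

definition Rminus :: "nat \<Rightarrow> poly \<Rightarrow> poly" where
  "Rminus i f = subst (Rminus_sub i) f"

definition Rplus :: "nat \<Rightarrow> poly \<Rightarrow> poly" where
  "Rplus i f = subst (Rplus_sub i) f"

text \<open>E_i f = (R_i^+ f - R_i^- f) / (x_i - t_i) (exact division in Z[x,t]).\<close>
definition E :: "nat \<Rightarrow> poly \<Rightarrow> poly" where
  "E i f = (THE g. (Var (X i) - Var (T i)) * g = Rplus i f - Rminus i f)"

datatype tree = Leaf | Node tree tree

fun nleaves :: "tree \<Rightarrow> nat" where
  "nleaves Leaf = 1"
| "nleaves (Node l r) = nleaves l + nleaves r"

text \<open>Local (0-based) leaf positions rho(v) of terminal nodes v of a tree.\<close>
fun qdes_tree :: "tree \<Rightarrow> nat set" where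
  "qdes_tree Leaf = {}"
| "qdes_tree (Node l r) =
     (if l = Leaf \<and> r = Leaf then {0}
      else qdes_tree l \<union> (\<lambda>j. j + nleaves l) ` qdes_tree r)"

fun del_tree :: "nat \<Rightarrow> tree \<Rightarrow> tree" where
  "del_tree j Leaf = Leaf"
| "del_tree j (Node l r) =
     (if l = Leaf \<and> r = Leaf then Leaf
      else if j < nleaves l then Node (del_tree j l) r
      else Node l (del_tree (j - nleaves l) r))"

type_synonym forest = "nat \<Rightarrow> tree"

definition indexed_forest :: "forest \<Rightarrow> bool" where
  "indexed_forest F \<longleftrightarrow> finite {k. F k \<noteq> Leaf}"

definition empty_forest :: forest where
  "empty_forest = (\<lambda>_. Leaf)"

text \<open>Global label (0-based) of the first leaf of tree k.\<close>
definition offset :: "forest \<Rightarrow> nat \<Rightarrow> nat" where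
  "offset F k = (\<Sum>j<k. nleaves (F j))"

definition Qdes :: "forest \<Rightarrow> nat set" where
  "Qdes F = (\<Union>k. (\<lambda>j. j + offset F k) ` qdes_tree (F k))"

definition forest_del :: "forest \<Rightarrow> nat \<Rightarrow> forest" where
  "forest_del F i = (\<lambda>k. if offset F k \<le> i \<and> i < offset F (Suc k)
                         then del_tree (i - offset F k) (F k) else F k)"

end

theory Submission
  imports Defs
begin

text \<open>
  The operators satisfy E j E i = E i E (j + 1) for i < j, where the left E j is taken in the
  alphabet without t_i and the right E i in the alphabet without t_(j+1). This is the only
  obstruction to integration: a family g i, almost all zero, satisfying the corresponding
  relations has the form g i = E i f, which is shown by removing the last nonzero g n at a time.
  Forests satisfy (F/i)/j = (F/(j+1))/i for i < j, so the required derivatives of the polynomial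
  of F are such a family by induction on the number of internal nodes. A polynomial
  killed by all E i involves no x at all: if x_n is its last variable, R_n^+ fixes it while R_n^-
  replaces x_n by t_n. Hence f is determined by its derivatives and its value at x = t.
\<close>

section \<open>Polynomials and substitutions\<close>

text \<open>An arbitrary linear order on the variables makes the polynomial ring an integral domain.\<close>

instantiation var :: linorder
begin

primrec var_code :: "var \<Rightarrow> nat" where
  "var_code (X n) = 2 * n"
| "var_code (T n) = 2 * n + 1"

definition less_eq_var :: "var \<Rightarrow> var \<Rightarrow> bool" where
  "v \<le> w \<longleftrightarrow> var_code v \<le> var_code w"

definition less_var :: "var \<Rightarrow> var \<Rightarrow> bool" where
  "v < w \<longleftrightarrow> var_code v < var_code w"

instance
proof
  fix v w :: var
  assume "v \<le> w" "w \<le> v"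
  then have "var_code v = var_code w" by (simp add: less_eq_var_def)
  then show "v = w" by (cases v; cases w; simp; presburger)
qed (auto simp: less_eq_var_def less_var_def)

end

definition mdeg :: "(var \<Rightarrow>\<^sub>0 nat) \<Rightarrow> nat" where
  "mdeg m = sum (Poly_Mapping.lookup m) (Poly_Mapping.keys m)"

text \<open>With the degree fixed, these polynomials (0 included) are closed under differences,
  which \<open>homogeneous\<close> alone is not.\<close>

definition hom :: "nat \<Rightarrow> poly \<Rightarrow> bool" where
  "hom d p \<longleftrightarrow> Poly_Mapping.keys p \<subseteq> {m. mdeg m = d}"

definition vars :: "poly \<Rightarrow> var set" where
  "vars p = (\<Union>m\<in>Poly_Mapping.keys p. Poly_Mapping.keys m)"

text \<open>Every substitution in the statement sends variables to variables. Such maps compose as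
  functions on \<open>var\<close>, so identities between them are checked by cases on a
  variable.\<close>

definition ren :: "(var \<Rightarrow> var) \<Rightarrow> poly \<Rightarrow> poly" where
  "ren \<phi> = subst (\<lambda>v. Var (\<phi> v))"

definition monom_eval :: "(var \<Rightarrow> poly) \<Rightarrow> (var \<Rightarrow>\<^sub>0 nat) \<Rightarrow> poly" where
  "monom_eval \<sigma> m = (\<Prod>v\<in>Poly_Mapping.keys m. \<sigma> v ^ Poly_Mapping.lookup m v)"

lemma keys_add_nat:
  fixes m n :: "'a \<Rightarrow>\<^sub>0 nat"
  shows "Poly_Mapping.keys (m + n) = Poly_Mapping.keys m \<union> Poly_Mapping.keys n"
  by (auto simp: in_keys_iff lookup_add)

lemma mdeg_add: "mdeg (m + n) = mdeg m + mdeg n"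
  unfolding mdeg_def by (rule setsum_keys_plus_distrib) auto

lemma mdeg_zero [simp]: "mdeg 0 = 0"
  by (simp add: mdeg_def)

lemma mdeg_single [simp]: "mdeg (Poly_Mapping.single v (Suc 0)) = Suc 0"
  by (simp add: mdeg_def)

lemma mdeg_eq_0_iff: "mdeg m = 0 \<longleftrightarrow> m = 0"
proof
  assume "mdeg m = 0"
  then have "\<forall>v\<in>Poly_Mapping.keys m. Poly_Mapping.lookup m v = 0"
    by (simp add: mdeg_def)
  then have "Poly_Mapping.keys m = {}" by blast
  then show "m = 0" by simp
qed simp

lemma monom_eval_add: "monom_eval \<sigma> (m + n) = monom_eval \<sigma> m * monom_eval \<sigma> n"
proof -
  let ?K = "Poly_Mapping.keys m \<union> Poly_Mapping.keys n"
  have *: "monom_eval \<sigma> k = (\<Prod>v\<in>?K. \<sigma> v ^ Poly_Mapping.lookup k v)"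
    if "Poly_Mapping.keys k \<subseteq> ?K" for k
    unfolding monom_eval_def
    by (rule prod.mono_neutral_left) (use that in \<open>auto simp: in_keys_iff\<close>)
  show ?thesis
    by (simp add: * keys_add_nat lookup_add power_add prod.distrib)
qed

lemma monom_eval_zero [simp]: "monom_eval \<sigma> 0 = 1"
  by (simp add: monom_eval_def)

lemma monom_eval_single [simp]: "monom_eval \<sigma> (Poly_Mapping.single v (Suc 0)) = \<sigma> v"
  by (simp add: monom_eval_def)

section \<open>Substitution as a ring homomorphism\<close>

lemma frag_cmul_eq_of_int_mult: "frag_cmul c p = of_int c * (p :: poly)"
proof -
  have "frag_cmul c p = Poly_Mapping.map ((*) c) p"
    by (rule poly_mapping_eqI) (simp add: Poly_Mapping.map.rep_eq when_def)
  then show ?thesis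
    by (simp only: mult_map_scale_conv_mult flip: single_of_int) simp
qed

text \<open>\<open>poly\<close> is also the free abelian group on monomials, so additivity of
  \<open>subst\<close> is inherited from \<open>frag_extend\<close>.\<close>

lemma subst_eq_frag_extend: "subst \<sigma> = frag_extend (monom_eval \<sigma>)"
  by (simp add: fun_eq_iff subst_def frag_extend_def monom_eval_def frag_cmul_eq_of_int_mult)

lemma subst_frag_of [simp]: "subst \<sigma> (frag_of m) = monom_eval \<sigma> m"
  by (simp add: subst_eq_frag_extend)

lemma frag_of_zero: "frag_of (0 :: var \<Rightarrow>\<^sub>0 nat) = 1"
  by simp

lemma frag_of_add: "frag_of (m + n) = (frag_of m * frag_of n :: poly)"
  by (simp add: mult_single)

lemma Var_eq_frag_of: "Var v = frag_of (Poly_Mapping.single v (Suc 0))"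
  by (simp add: Var_def)

lemma frag_of_Var_add: "frag_of (Poly_Mapping.single v (Suc 0) + m) = Var v * frag_of m"
  by (simp add: frag_of_add Var_eq_frag_of)

lemma subst_diff: "subst \<sigma> (p - q) = subst \<sigma> p - subst \<sigma> q"
  by (simp add: subst_eq_frag_extend frag_extend_diff)

lemma subst_zero [simp]: "subst \<sigma> 0 = 0"
  by (simp add: subst_eq_frag_extend)

lemma subst_one [simp]: "subst \<sigma> 1 = 1"
  using subst_frag_of[of \<sigma> 0] by (simp del: subst_frag_of)

lemma subst_Var [simp]: "subst \<sigma> (Var v) = \<sigma> v"
  by (simp add: Var_eq_frag_of)

text \<open>Both sides are additive in p and in q; two inductions leave a product of monomials,
  settled by \<open>monom_eval_add\<close>.\<close>

lemma subst_mult: "subst \<sigma> (p * q) = subst \<sigma> p * subst \<sigma> q"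
proof -
  have 1: "subst \<sigma> (frag_of m * q) = monom_eval \<sigma> m * subst \<sigma> q" for m
  proof (induction rule: frag_induction[OF subset_UNIV, of _ q])
    case (2 n)
    show ?case by (simp only: subst_frag_of monom_eval_add flip: frag_of_add)
  next
    case (3 a b)
    then show ?case by (simp only: right_diff_distrib subst_diff)
  qed simp
  show ?thesis
  proof (induction rule: frag_induction[OF subset_UNIV, of _ p])
    case (2 n)
    show ?case by (simp only: 1 subst_frag_of)
  next
    case (3 a b)
    then show ?case by (simp only: left_diff_distrib subst_diff)
  qed simp
qed

lemma monom_induct [case_names zero Var]:
  assumes "P 0" and "\<And>v m. P m \<Longrightarrow> P (Poly_Mapping.single v (Suc 0) + m)"
  shows "P (m :: var \<Rightarrow>\<^sub>0 nat)"
proof (induction "mdeg m" arbitrary: m)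
  case 0
  then show ?case using assms(1) by (simp add: mdeg_eq_0_iff)
next
  case (Suc n)
  then have "m \<noteq> 0" by auto
  then obtain v where v: "Poly_Mapping.lookup m v \<noteq> 0"
    by (metis lookup_zero poly_mapping_eqI)
  \<comment> \<open>Subtraction of exponents is truncated; nothing is lost because the exponent of v
    is positive.\<close>
  have m: "m = Poly_Mapping.single v (Suc 0) + (m - Poly_Mapping.single v (Suc 0))"
    using v by (intro poly_mapping_eqI) (auto simp: lookup_add lookup_minus lookup_single when_def)
  have "mdeg m = 1 + mdeg (m - Poly_Mapping.single v (Suc 0))"
    by (subst m) (simp only: mdeg_add mdeg_single One_nat_def)
  then show ?case using Suc assms(2) m by (metis add_left_imp_eq plus_1_eq_Suc)
qed

text \<open>Reduces identities between ring homomorphisms to variables. Closure under differences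
  covers sums and negatives at once.\<close>

lemma poly_induct [case_names zero one Var diff]:
  assumes "P 0" "P 1" "\<And>v p. P p \<Longrightarrow> P (Var v * p)" "\<And>p q. P p \<Longrightarrow> P q \<Longrightarrow> P (p - q)"
  shows "P (p :: poly)"
proof -
  have "P (frag_of m)" for m
    by (induction m rule: monom_induct)
       (simp_all only: assms frag_of_zero frag_of_Var_add)
  then show ?thesis
    by (induction rule: frag_induction[OF subset_UNIV, of _ p]) (simp_all only: assms)
qed

section \<open>Renamings of variables\<close>

lemma ren_diff: "ren \<phi> (p - q) = ren \<phi> p - ren \<phi> q"
  and ren_mult: "ren \<phi> (p * q) = ren \<phi> p * ren \<phi> q"
  and ren_zero [simp]: "ren \<phi> 0 = 0"
  and ren_one [simp]: "ren \<phi> 1 = 1"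
  and ren_Var [simp]: "ren \<phi> (Var v) = Var (\<phi> v)"
  by (simp_all add: ren_def subst_diff subst_mult)

lemma ren_id [simp]: "ren (\<lambda>v. v) p = p"
  by (induction p rule: poly_induct) (auto simp: ren_diff ren_mult)

lemma ren_ren: "ren \<phi> (ren \<psi> p) = ren (\<lambda>v. \<phi> (\<psi> v)) p"
  by (induction p rule: poly_induct) (auto simp: ren_diff ren_mult)

lemma ren_cong: "(\<And>v. v \<in> vars p \<Longrightarrow> \<phi> v = \<psi> v) \<Longrightarrow> ren \<phi> p = ren \<psi> p"
  unfolding ren_def subst_def vars_def
  by (intro sum.cong refl arg_cong2[of _ _ _ _ "(*)"] prod.cong) (metis UN_I)

lemma ren_cong_id: "(\<And>v. v \<in> vars p \<Longrightarrow> \<phi> v = v) \<Longrightarrow> ren \<phi> p = p"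
  using ren_cong[of p \<phi> "\<lambda>v. v"] by simp

lemma finite_vars [simp]: "finite (vars p)"
  by (simp add: vars_def)

lemma vars_mult: "vars (p * q) \<subseteq> vars p \<union> vars q"
  using keys_mult[of p q] by (fastforce simp: vars_def keys_add_nat)

lemma vars_diff: "vars (p - q) \<subseteq> vars p \<union> vars q"
  using keys_diff[of p q] by (fastforce simp: vars_def)

lemma vars_zero [simp]: "vars 0 = {}" and vars_one [simp]: "vars 1 = {}"
  and vars_Var [simp]: "vars (Var v) = {v}"
  by (auto simp: vars_def Var_def)

lemma vars_ren: "vars (ren \<phi> p) \<subseteq> \<phi> ` vars p"
proof -
  have 1: "vars (ren \<phi> (frag_of m)) \<subseteq> \<phi> ` Poly_Mapping.keys m" for m
  proof (induction m rule: monom_induct)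
    case (Var v m)
    then show ?case
      using vars_mult[of "ren \<phi> (Var v)" "ren \<phi> (frag_of m)"]
      by (auto simp: keys_add_nat frag_of_Var_add ren_mult)
  qed simp
  \<comment> \<open>The bound uses a fixed S instead of the support of p, because cancellation can
    make the support of a difference smaller than those of its parts.\<close>
  have "vars (ren \<phi> p) \<subseteq> (\<Union>m\<in>S. \<phi> ` Poly_Mapping.keys m)" if "Poly_Mapping.keys p \<subseteq> S" for S
    using that
  proof (induction p rule: frag_induction)
    case (one m)
    then show ?case using 1[of m] by blast
  next
    case (diff p q)
    then show ?case using vars_diff[of "ren \<phi> p" "ren \<phi> q"] by (auto simp: ren_diff)
  qed simp
  from this[OF order_refl] show ?thesis by (simp add: vars_def image_UN)
qed

section \<open>Homogeneity\<close>

lemma hom_zero [simp]: "hom d 0" by (simp add: hom_def)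

lemma hom_one [simp]: "hom 0 1" by (simp add: hom_def)

lemma hom_Var [simp]: "hom (Suc 0) (Var v)" by (simp add: hom_def Var_def)

lemma hom_diff: "hom d p \<Longrightarrow> hom d q \<Longrightarrow> hom d (p - q)"
  using keys_diff[of p q] unfolding hom_def by blast

lemma hom_add: "hom d p \<Longrightarrow> hom d q \<Longrightarrow> hom d (p + q)"
  using keys_add[of p q] unfolding hom_def by blast

lemma hom_mult: "hom d p \<Longrightarrow> hom e q \<Longrightarrow> hom (d + e) (p * q)"
  using keys_mult[of p q] unfolding hom_def by (fastforce simp: mdeg_add)

lemma hom_ren: "hom d p \<Longrightarrow> hom d (ren \<phi> p)"
proof -
  have 1: "hom (mdeg m) (ren \<phi> (frag_of m))" for m
  proof (induction m rule: monom_induct)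
    case (Var v m)
    then show ?case
      using hom_mult[of "Suc 0" "ren \<phi> (Var v)"]
      by (auto simp: mdeg_add frag_of_Var_add ren_mult)
  qed simp
  assume "hom d p"
  then show ?thesis unfolding hom_def[of d p]
    by (induction p rule: frag_induction) (use 1 in \<open>auto simp: ren_diff hom_diff\<close>)
qed

lemma homogeneous_if_hom: "hom d p \<Longrightarrow> homogeneous p"
  unfolding homogeneous_def hom_def mdeg_def by blast

section \<open>Divided differences\<close>

fun insR :: "nat \<Rightarrow> nat \<Rightarrow> var \<Rightarrow> var" where
  "insR j k (X i) = (if i \<le> j then X i else if i = Suc j then T k else X (i - 1))"
| "insR j k (T i) = T i"

fun insL :: "nat \<Rightarrow> nat \<Rightarrow> var \<Rightarrow> var" where
  "insL j k (X i) = (if i < j then X i else if i = j then T k else X (i - 1))"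
| "insL j k (T i) = T i"

fun hat_var :: "nat \<Rightarrow> var \<Rightarrow> var" where
  "hat_var i (X j) = X j"
| "hat_var i (T j) = (if j < i then T j else T (Suc j))"

fun diag_var :: "var \<Rightarrow> var" where
  "diag_var (X j) = T j"
| "diag_var (T j) = T j"

text \<open>
  The operator E j inserts the j-th letter of its alphabet. In the alphabet hat_t i with i \<le> j
  that letter is T (Suc j), so the letter needs an index k of its own.
\<close>

definition EE :: "nat \<Rightarrow> nat \<Rightarrow> poly \<Rightarrow> poly" where
  "EE j k f = (THE g. (Var (X j) - Var (T k)) * g = ren (insR j k) f - ren (insL j k) f)"

section \<open>The operators of the statement as renamings\<close>

lemma subst_at_t: "subst at_t = ren diag_var"
  unfolding ren_def by (rule arg_cong[of _ _ subst]) (auto simp: fun_eq_iff at_t_def split: var.split)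

lemma subst_hat_t: "subst (hat_t i) = ren (hat_var i)"
  unfolding ren_def by (rule arg_cong[of _ _ subst]) (auto simp: fun_eq_iff hat_t_def split: var.split)

lemma Rplus_eq_ren: "Rplus i = ren (insR i i)"
  unfolding ren_def Rplus_def[abs_def]
  by (intro ext arg_cong2[of _ _ _ _ subst]) (auto simp: fun_eq_iff Rplus_sub_def split: var.split)

lemma Rminus_eq_ren: "Rminus i = ren (insL i i)"
  unfolding ren_def Rminus_def[abs_def]
  by (intro ext arg_cong2[of _ _ _ _ subst]) (auto simp: fun_eq_iff Rminus_sub_def split: var.split)

lemma E_eq_EE: "E i = EE i i"
  by (simp add: fun_eq_iff E_def EE_def Rplus_eq_ren Rminus_eq_ren)

lemma Var_inj: "Var v = Var w \<longleftrightarrow> v = w"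
  by (metis vars_Var singleton_inject)

text \<open>Makes the quotient in \<open>EE\<close> unique: the factor is nonzero and polynomials
  form an integral domain.\<close>

lemma XT_cancel: "(Var (X j) - Var (T k)) * p = (Var (X j) - Var (T k)) * q \<longleftrightarrow> p = q"
  by (simp add: Var_inj)

text \<open>Twisted Leibniz rule, with R+ and R- the two insertions: R+(v m) - R-(v m) = R+(v)
  (R+(m) - R-(m)) + (R+(v) - R-(v)) R-(m). Induction over the monomial thus reduces divisibility to
  single variables.\<close>

lemma XT_dvd_monom:
  "\<exists>g. (Var (X j) - Var (T k)) * g = ren (insR j k) (frag_of m) - ren (insL j k) (frag_of m) \<and>
       hom (mdeg m - 1) g \<and> (m = 0 \<longrightarrow> g = 0)"
proof (induction m rule: monom_induct)
  case zero
  then show ?case by (intro exI[of _ 0]) simp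
next
  case (Var v m)
  then obtain g where g: "(Var (X j) - Var (T k)) * g = ren (insR j k) (frag_of m) - ren (insL j k) (frag_of m)"
    "hom (mdeg m - 1) g" "m = 0 \<longrightarrow> g = 0" by blast
  \<comment> \<open>The insertions differ only on \<open>X j\<close>, sent to \<open>X j\<close> and
    \<open>T k\<close>, and on \<open>X (Suc j)\<close>, sent to \<open>T k\<close> and
    \<open>X j\<close>; c is the quotient for v.\<close>
  define c :: poly where "c = (if v = X j then 1 else if v = X (Suc j) then - 1 else 0)"
  have c: "(Var (X j) - Var (T k)) * c = Var (insR j k v) - Var (insL j k v)"
    by (cases v) (auto simp: c_def)
  have hc: "hom 0 c" by (simp add: c_def) (simp add: hom_def)
  define h where "h = Var (insR j k v) * g + c * ren (insL j k) (frag_of m)"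
  \<comment> \<open>For m = 0 the truncated \<open>mdeg m - 1\<close> is 0 and the degree count
    fails; there g = 0 helps.\<close>
  have "hom (mdeg m) (Var (insR j k v) * g)"
  proof (cases "m = 0")
    case False
    then have "mdeg m = Suc 0 + (mdeg m - 1)" by (metis mdeg_eq_0_iff One_nat_def Suc_pred add_Suc plus_nat.add_0 not_gr0)
    then show ?thesis using hom_mult[OF hom_Var g(2)] by metis
  qed (use g(3) in auto)
  moreover have "hom (0 + mdeg m) (c * ren (insL j k) (frag_of m))"
    by (intro hom_mult hc hom_ren) (simp add: hom_def)
  ultimately have "hom (mdeg m) h" by (simp add: h_def hom_add)
  moreover have "(Var (X j) - Var (T k)) * h =
      Var (insR j k v) * ((Var (X j) - Var (T k)) * g) + ((Var (X j) - Var (T k)) * c) * ren (insL j k) (frag_of m)"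
    by (simp add: h_def algebra_simps)
  then have "(Var (X j) - Var (T k)) * h =
      ren (insR j k) (Var v * frag_of m) - ren (insL j k) (Var v * frag_of m)"
    unfolding g(1) c ren_mult ren_Var by (simp add: algebra_simps)
  moreover have "Poly_Mapping.single v (Suc 0) + m \<noteq> 0"
    by (metis mdeg_add mdeg_single mdeg_eq_0_iff add_is_0 nat.distinct(1))
  ultimately show ?case
    by (intro exI[of _ h]) (simp add: frag_of_Var_add mdeg_add)
qed

text \<open>The fixed S carries the degree through the induction, so that one quotient serves
  divisibility and homogeneity; S = UNIV gives divisibility alone.\<close>

lemma XT_dvd:
  assumes "Poly_Mapping.keys f \<subseteq> S"
  shows "\<exists>g. (Var (X j) - Var (T k)) * g = ren (insR j k) f - ren (insL j k) f \<and>
         (\<forall>d. S \<subseteq> {m. mdeg m = Suc d} \<longrightarrow> hom d g)"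
  using assms
proof (induction f rule: frag_induction)
  case zero
  then show ?case by (intro exI[of _ 0]) simp
next
  case (one m)
  then show ?case using XT_dvd_monom[of j k m] by (fastforce simp: subset_iff)
next
  case (diff a b)
  then obtain g h where "(Var (X j) - Var (T k)) * g = ren (insR j k) a - ren (insL j k) a"
    "(Var (X j) - Var (T k)) * h = ren (insR j k) b - ren (insL j k) b"
    "\<forall>d. S \<subseteq> {m. mdeg m = Suc d} \<longrightarrow> hom d g" "\<forall>d. S \<subseteq> {m. mdeg m = Suc d} \<longrightarrow> hom d h"
    by blast
  then show ?case
    by (intro exI[of _ "g - h"]) (simp add: hom_diff ren_diff right_diff_distrib[of "_ - _"])
qed

lemma EE_eqI: "(Var (X j) - Var (T k)) * g = ren (insR j k) f - ren (insL j k) f \<Longrightarrow> EE j k f = g"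
  unfolding EE_def by (rule the_equality) (simp_all only: XT_cancel flip: XT_cancel[of j k _ g])

lemma EE_mult: "(Var (X j) - Var (T k)) * EE j k f = ren (insR j k) f - ren (insL j k) f"
  using XT_dvd[OF subset_UNIV, of j k f] EE_eqI by blast

lemma hom_EE: "hom (Suc d) f \<Longrightarrow> hom d (EE j k f)"
  using XT_dvd[of f "{m. mdeg m = Suc d}" j k] EE_eqI unfolding hom_def[of "Suc d"] by blast

lemma EE_diff: "EE j k (f - g) = EE j k f - EE j k g"
  by (rule EE_eqI) (simp add: right_diff_distrib[of "_ - _"] EE_mult ren_diff)

lemma EE_zero [simp]: "EE j k 0 = 0"
  by (rule EE_eqI) simp

lemma EE_eq_0_iff: "EE j k f = 0 \<longleftrightarrow> ren (insR j k) f = ren (insL j k) f"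
  by (metis EE_mult XT_cancel mult_zero_right eq_iff_diff_eq_0)

text \<open>The two insertions agree on every t and on each x before position j.\<close>

lemma EE_eq_0_if_vars:
  assumes "\<And>m. X m \<in> vars f \<Longrightarrow> m < j"
  shows "EE j k f = 0"
proof -
  have "insR j k v = insL j k v" if "v \<in> vars f" for v
    using assms that by (cases v) fastforce+
  then show ?thesis unfolding EE_eq_0_iff by (rule ren_cong)
qed

text \<open>The letter at position j of the alphabet without t_i is \<open>T j\<close> before i and
  \<open>T (Suc j)\<close> from i on; with that letter both insertions commute with
  \<open>hat_var i\<close>.\<close>

lemma EE_ren_hat_var:
  "EE j (if j < i then j else Suc j) (ren (hat_var i) f) = ren (hat_var i) (EE j j f)"
proof (rule EE_eqI)
  let ?k = "if j < i then j else Suc j"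
  have R: "ren (insR j ?k) (ren (hat_var i) f) = ren (hat_var i) (ren (insR j j) f)"
    unfolding ren_ren by (rule ren_cong, rename_tac v, case_tac v) auto
  have L: "ren (insL j ?k) (ren (hat_var i) f) = ren (hat_var i) (ren (insL j j) f)"
    unfolding ren_ren by (rule ren_cong, rename_tac v, case_tac v) auto
  have "Var (X j) - Var (T ?k) = ren (hat_var i) (Var (X j) - Var (T j))"
    by (simp add: ren_diff)
  then show "(Var (X j) - Var (T ?k)) * ren (hat_var i) (EE j j f)
    = ren (insR j ?k) (ren (hat_var i) f) - ren (insL j ?k) (ren (hat_var i) f)"
    unfolding R L by (simp only: EE_mult flip: ren_mult ren_diff)
qed

text \<open>All four pairs of insertions commute in this shifted form, so both sides agree after
  multiplication by the two linear factors, which cancel.\<close>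

lemma EE_commute:
  assumes "i < j"
  shows "EE j (Suc j) (EE i i f) = EE i i (EE (Suc j) (Suc j) f)"
proof -
  have comm: "ren (A j (Suc j)) (ren (B i i) f) = ren (B i i) (ren (A (Suc j) (Suc j)) f)"
    if "A \<in> {insR, insL}" "B \<in> {insR, insL}" for A B
    unfolding ren_ren by (rule ren_cong, rename_tac v, case_tac v) (use that assms in auto)
  let ?a = "Var (X i) - Var (T i)" and ?b = "Var (X j) - Var (T (Suc j))"
    and ?c = "Var (X (Suc j)) - Var (T (Suc j))"
  \<comment> \<open>An insertion at j > i leaves \<open>X i\<close> and \<open>T i\<close> alone,
    while one at i moves \<open>X (Suc j)\<close> to \<open>X j\<close>.\<close>
  have a: "ren (A j (Suc j)) ?a = ?a" and b: "ren (A i i) ?c = ?b" if "A \<in> {insR, insL}" for A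
    using that assms by (auto simp: ren_diff)
  have "?a * (?b * EE j (Suc j) (EE i i f))
      = ren (insR j (Suc j)) ?a * ren (insR j (Suc j)) (EE i i f)
        - ren (insL j (Suc j)) ?a * ren (insL j (Suc j)) (EE i i f)"
    by (simp add: EE_mult right_diff_distrib[of ?a] a)
  also have "\<dots> = ren (insR i i) (?c * EE (Suc j) (Suc j) f) - ren (insL i i) (?c * EE (Suc j) (Suc j) f)"
    unfolding ren_mult[symmetric] EE_mult by (simp add: ren_diff comm)
  also have "\<dots> = ?b * (?a * EE i i (EE (Suc j) (Suc j) f))"
    by (simp add: ren_mult b EE_mult[of i i] right_diff_distrib[of ?b])
  finally show ?thesis
    by (simp only: mult.left_commute[of ?b ?a] XT_cancel)
qed

text \<open>The letters \<open>k j\<close> are arbitrary: integration takes \<open>Suc j\<close>,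
  the uniqueness argument takes j itself.\<close>

lemma no_X_vars_if_EE_eq_0:
  assumes "\<And>j. j \<ge> n \<Longrightarrow> EE j (k j) f = 0" and "X m \<in> vars f"
  shows "m < n"
proof (rule ccontr)
  let ?M = "{m. X m \<in> vars f}"
  define M where "M = Max ?M"
  assume "\<not> m < n"
  have "finite ?M"
    using finite_vimageI[OF finite_vars, of X f] by (simp add: vimage_def inj_def)
  then have M: "X M \<in> vars f" "\<And>i. X i \<in> vars f \<Longrightarrow> i \<le> M" "m \<le> M"
    unfolding M_def using assms(2) Max_in[of ?M] by auto
  then have "ren (insL M (k M)) f = ren (insR M (k M)) f"
    using assms(1)[of M] \<open>\<not> m < n\<close> by (simp add: EE_eq_0_iff)
  also have "\<dots> = f"
    by (rule ren_cong_id, rename_tac v, case_tac v) (use M in auto)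
  finally have "vars f \<subseteq> insL M (k M) ` vars f"
    using vars_ren[of "insL M (k M)" f] by simp
  \<comment> \<open>\<open>X M\<close> could only come from \<open>X (Suc M)\<close>, against the
    maximality of M.\<close>
  then obtain v where "v \<in> vars f" "X M = insL M (k M) v"
    using M(1) by blast
  then show False
    using M(2) by (cases v) (force split: if_splits)+
qed

text \<open>
  The candidate h = (X n - T n) * g n has the right E n, as g n involves no X m with m > n, and
  it is killed by E i for i > n; subtracting its derivatives from g shortens the family.
\<close>

lemma EE_integrable:
  assumes "\<And>i. i \<ge> n \<Longrightarrow> g i = 0"
    and "\<And>i j. i < j \<Longrightarrow> EE j (Suc j) (g i) = EE i i (g (Suc j))"
    and "\<And>i. hom d (g i)"
  shows "\<exists>f. hom (Suc d) f \<and> (\<forall>i. EE i i f = g i)"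
  using assms
proof (induction n arbitrary: g)
  case 0
  then show ?case by (intro exI[of _ 0]) simp
next
  case (Suc n)
  define h where "h = (Var (X n) - Var (T n)) * g n"
  have hom_h: "hom (Suc d) h"
    unfolding h_def using hom_mult[OF hom_diff[OF hom_Var hom_Var] Suc.prems(3)] by simp
  \<comment> \<open>By compatibility this is \<open>EE n n (g (Suc j))\<close>, and
    \<open>g (Suc j)\<close> vanishes.\<close>
  have "EE j (Suc j) (g n) = 0" if "j \<ge> Suc n" for j
    using that Suc.prems(1,2) by simp
  then have vars_g: "m \<le> n" if "X m \<in> vars (g n)" for m
    using no_X_vars_if_EE_eq_0[of "Suc n" Suc] that by (meson less_Suc_eq_le)
  have "ren (insR n n) (g n) = g n"
    by (rule ren_cong_id, rename_tac v, case_tac v) (use vars_g in auto)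
  \<comment> \<open>\<open>insL n n\<close> sends both \<open>X n\<close> and \<open>T n\<close> to
    \<open>T n\<close> and so kills h, while \<open>insR n n\<close> fixes h.\<close>
  then have h_n: "EE n n h = g n"
    by (intro EE_eqI) (simp add: h_def ren_mult ren_diff)
  have h_gt: "EE i i h = 0" if "i > n" for i
  proof (rule EE_eq_0_if_vars)
    fix m assume "X m \<in> vars h"
    then have "X m \<in> vars (Var (X n) - Var (T n)) \<or> X m \<in> vars (g n)"
      using vars_mult unfolding h_def by blast
    then have "m \<le> n"
      using vars_diff[of "Var (X n)" "Var (T n)"] vars_g by auto
    then show "m < i" using that by simp
  qed
  \<comment> \<open>The corrected family vanishes from n on and is still compatible, since by
    \<open>EE_commute\<close> the derivatives of h are.\<close>
  have "\<exists>f. hom (Suc d) f \<and> (\<forall>i. EE i i f = g i - EE i i h)"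
  proof (rule Suc.IH)
    show "g i - EE i i h = 0" if "i \<ge> n" for i
      using that h_n h_gt Suc.prems(1) by (cases "i = n") auto
    show "hom d (g i - EE i i h)" for i
      using hom_h Suc.prems(3) by (intro hom_diff hom_EE)
    show "EE j (Suc j) (g i - EE i i h) = EE i i (g (Suc j) - EE (Suc j) (Suc j) h)" if "i < j" for i j
      using that by (simp add: EE_diff EE_commute Suc.prems(2))
  qed
  then obtain f where f: "hom (Suc d) f" "\<And>i. EE i i f = g i - EE i i h" by blast
  \<comment> \<open>This is f + h, written so that \<open>EE_diff\<close> applies.\<close>
  have "EE i i (f - (0 - h)) = g i" for i
    unfolding EE_diff f(2) by simp
  moreover have "hom (Suc d) (f - (0 - h))"
    using f(1) hom_h by (intro hom_diff) auto
  ultimately show ?case by blast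
qed

section \<open>Forests\<close>

lemma qdes_tree_Node:
  "x \<in> qdes_tree (Node l r) \<longleftrightarrow>
     l = Leaf \<and> r = Leaf \<and> x = 0 \<or> x \<in> qdes_tree l \<or> (\<exists>c\<in>qdes_tree r. x = c + nleaves l)"
  by auto

lemma nleaves_pos [simp]: "0 < nleaves t"
  by (induction t) auto

lemma nleaves_eq_1_iff: "nleaves t = Suc 0 \<longleftrightarrow> t = Leaf"
proof (cases t)
  case (Node l r)
  then have "nleaves t \<noteq> Suc 0"
    using nleaves_pos[of l] nleaves_pos[of r] by (simp del: nleaves_pos)
  then show ?thesis using Node by simp
qed simp

lemma Suc_less_nleaves_if_qdes_tree: "a \<in> qdes_tree t \<Longrightarrow> Suc a < nleaves t"
proof (induction t arbitrary: a)
  case (Node l r)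
  then show ?case
    using nleaves_pos[of l] nleaves_pos[of r] unfolding qdes_tree_Node by fastforce
qed simp

lemma del_tree_left: "a \<in> qdes_tree l \<Longrightarrow> del_tree a (Node l r) = Node (del_tree a l) r"
  using Suc_less_nleaves_if_qdes_tree[of a l] by auto

lemma del_tree_right: "c \<in> qdes_tree r \<Longrightarrow> del_tree (c + nleaves l) (Node l r) = Node l (del_tree c r)"
  by auto

lemma nleaves_del_tree: "a \<in> qdes_tree t \<Longrightarrow> Suc (nleaves (del_tree a t)) = nleaves t"
proof (induction t arbitrary: a)
  case (Node l r)
  from Node.prems consider "l = Leaf" "r = Leaf" | "a \<in> qdes_tree l"
    | c where "c \<in> qdes_tree r" "a = c + nleaves l"
    unfolding qdes_tree_Node by blast
  then show ?case
  proof cases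
    case 2
    then show ?thesis using Node.IH(1)[of a] by (simp add: del_tree_left del: del_tree.simps)
  next
    case 3
    then show ?thesis using Node.IH(2)[of c] by (simp add: del_tree_right del: del_tree.simps)
  qed simp
qed simp

text \<open>A terminal node at b > a of the contracted tree has leaves b and b + 1, so it avoids the
  new leaf a and was terminal before; the lost leaf explains its old label
  \<open>Suc b\<close>.\<close>

lemma del_tree_commute:
  assumes "a < b" "a \<in> qdes_tree t" "b \<in> qdes_tree (del_tree a t)"
  shows "Suc b \<in> qdes_tree t \<and> a \<in> qdes_tree (del_tree (Suc b) t) \<and>
         del_tree b (del_tree a t) = del_tree a (del_tree (Suc b) t)"
  using assms
proof (induction t arbitrary: a b)
  case (Node l r)
  note [simp del] = del_tree.simps qdes_tree.simps
  from Node.prems(2) consider "l = Leaf" "r = Leaf" | "a \<in> qdes_tree l"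
    | c where "c \<in> qdes_tree r" "a = c + nleaves l"
    unfolding qdes_tree_Node by blast
  then show ?case
  proof cases
    case 1
    then show ?thesis using Node.prems(3) by (simp add: del_tree.simps qdes_tree.simps)
  next
    case 2
    then have "b \<in> qdes_tree (del_tree a l) \<or> (\<exists>c\<in>qdes_tree r. b = c + nleaves (del_tree a l))"
      using Node.prems by (auto simp: del_tree_left qdes_tree_Node)
    then show ?thesis
    proof
      assume b: "b \<in> qdes_tree (del_tree a l)"
      note IH = Node.IH(1)[OF Node.prems(1) 2 b]
      then show ?thesis using 2 b by (simp add: del_tree_left qdes_tree_Node)
    next
      assume "\<exists>c\<in>qdes_tree r. b = c + nleaves (del_tree a l)"
      then obtain c where c: "c \<in> qdes_tree r" "b = c + nleaves (del_tree a l)" by blast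
      then have Sb: "Suc b = c + nleaves l" using nleaves_del_tree[OF 2] by simp
      show ?thesis unfolding Sb unfolding c(2) using 2 c(1)
        by (simp add: del_tree_left del_tree_right qdes_tree_Node)
    qed
  next
    case 3
    have "b \<notin> qdes_tree l"
      using Suc_less_nleaves_if_qdes_tree[of b l] 3 Node.prems(1) by auto
    then obtain e where e: "e \<in> qdes_tree (del_tree c r)" "b = e + nleaves l"
      using 3 Node.prems by (auto simp: del_tree_right qdes_tree_Node)
    have "c < e" using 3 e Node.prems(1) by simp
    note IH = Node.IH(2)[OF this 3(1) e(1)]
    have Sb: "Suc b = Suc e + nleaves l" using e by simp
    show ?thesis unfolding Sb unfolding e(2) 3(2) using IH e(1) 3(1)
      by (simp add: del_tree_right qdes_tree_Node del: add_Suc)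
  qed
qed simp

text \<open>Converse of \<open>del_tree_commute\<close>: after contraction at \<open>Suc b\<close>
  the node at a has leaves a and a + 1, both below the new leaf \<open>Suc b\<close>, so it was
  terminal before.\<close>

lemma qdes_tree_del_tree_commute:
  assumes "a < b" "Suc b \<in> qdes_tree t" "a \<in> qdes_tree (del_tree (Suc b) t)"
  shows "a \<in> qdes_tree t \<and> b \<in> qdes_tree (del_tree a t)"
  using assms
proof (induction t arbitrary: a b)
  case (Node l r)
  note [simp del] = del_tree.simps qdes_tree.simps
  from Node.prems(2) consider "Suc b \<in> qdes_tree l"
    | c where "c \<in> qdes_tree r" "Suc b = c + nleaves l"
    unfolding qdes_tree_Node by blast
  then show ?case
  proof cases
    case 1
    note n = nleaves_del_tree[OF 1] Suc_less_nleaves_if_qdes_tree[OF 1]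
    then have "a \<in> qdes_tree (del_tree (Suc b) l)"
      using Node.prems 1 by (auto simp: del_tree_left qdes_tree_Node)
    then show ?thesis
      using Node.IH(1)[OF Node.prems(1) 1] by (simp add: del_tree_left qdes_tree_Node)
  next
    case 2
    note n = nleaves_del_tree[OF 2(1)] Suc_less_nleaves_if_qdes_tree[OF 2(1)]
    have "a \<in> qdes_tree (Node l (del_tree c r))"
      using Node.prems(3) unfolding 2(2) del_tree_right[OF 2(1)] .
    then have "a \<in> qdes_tree l \<or> (\<exists>e\<in>qdes_tree (del_tree c r). a = e + nleaves l)"
      using Node.prems(1) n 2(2) by (auto simp: qdes_tree_Node)
    then show ?thesis
    proof
      assume a: "a \<in> qdes_tree l"
      then have "b = c + nleaves (del_tree a l)" using nleaves_del_tree[OF a] 2 by simp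
      then show ?thesis using a 2(1) by (auto simp: del_tree_left qdes_tree_Node)
    next
      assume "\<exists>e\<in>qdes_tree (del_tree c r). a = e + nleaves l"
      then obtain e where e: "e \<in> qdes_tree (del_tree c r)" "a = e + nleaves l" by blast
      \<comment> \<open>The induction hypothesis needs a successor; c is positive because a < b
        forces e < c.\<close>
      then obtain f where f: "c = Suc f" using 2 Node.prems(1) by (cases c) auto
      then have b: "b = f + nleaves l" using 2 by simp
      have "e \<in> qdes_tree r \<and> f \<in> qdes_tree (del_tree e r)"
        using Node.IH(2)[of e f] 2 e f b Node.prems(1) by simp
      then show ?thesis unfolding b e(2) by (auto simp: del_tree_right qdes_tree_Node)
    qed
  qed
qed simp

section \<open>Contraction in a forest\<close>

lemma offset_Suc [simp]: "offset F (Suc k) = offset F k + nleaves (F k)"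
  by (simp add: offset_def)

lemma offset_mono: "k \<le> l \<Longrightarrow> offset F k \<le> offset F l"
  unfolding offset_def by (rule sum_mono2) auto

lemma offset_block_le:
  assumes "a < nleaves (F k)" "a + offset F k \<le> b + offset F l" "b < nleaves (F l)"
  shows "k \<le> l"
proof (rule ccontr)
  assume "\<not> k \<le> l"
  then have "offset F (Suc l) \<le> offset F k" by (intro offset_mono) simp
  then show False using assms by simp
qed

lemma Qdes_iff: "i \<in> Qdes F \<longleftrightarrow> (\<exists>k. \<exists>a\<in>qdes_tree (F k). i = a + offset F k)"
  by (auto simp: Qdes_def)

text \<open>Each leaf label lies in exactly one block, so the interval test of
  \<open>forest_del\<close> becomes an update at one tree.\<close>

lemma forest_del_block:
  assumes "a < nleaves (F k)"
  shows "forest_del F (a + offset F k) = F(k := del_tree a (F k))"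
proof
  fix l
  have "l = k" if "offset F l \<le> a + offset F k" "a + offset F k < offset F (Suc l)"
  proof -
    have eq: "a + offset F k = (a + offset F k - offset F l) + offset F l" using that by simp
    show ?thesis
      using offset_block_le[of a F k "a + offset F k - offset F l" l]
        offset_block_le[of "a + offset F k - offset F l" F l a k] that eq assms
      by (intro antisym) auto
  qed
  then show "forest_del F (a + offset F k) l = (F(k := del_tree a (F k))) l"
    using assms by (auto simp: forest_del_def)
qed

lemma offset_upd_le: "l \<le> k \<Longrightarrow> offset (F(k := t)) l = offset F l"
  unfolding offset_def by (rule sum.cong) auto

text \<open>For nodes in different trees, this is where the shift from j to \<open>Suc j\<close>
  comes from.\<close>

lemma offset_upd_gt:
  assumes "k < l" "Suc (nleaves t) = nleaves (F k)"
  shows "Suc (offset (F(k := t)) l) = offset F l"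
  using assms(1)
proof (induction l)
  case (Suc l)
  then show ?case
    using assms(2) offset_upd_le[of l k F t] by (cases "k = l") (simp_all del: fun_upd_apply add: fun_upd_same fun_upd_other)
qed simp

lemma forest_del_qdes:
  "a \<in> qdes_tree (F k) \<Longrightarrow> forest_del F (a + offset F k) = F(k := del_tree a (F k))"
  using Suc_less_nleaves_if_qdes_tree[of a "F k"] by (simp add: forest_del_block)

text \<open>As i < j, the tree of j is not before that of i. In the same tree the claim is
  \<open>del_tree_commute\<close>; in different trees the updates are independent and only offsets
  move.\<close>

lemma forest_del_commute:
  assumes "i < j" "i \<in> Qdes F" "j \<in> Qdes (forest_del F i)"
  shows "Suc j \<in> Qdes F \<and> i \<in> Qdes (forest_del F (Suc j)) \<and>
         forest_del (forest_del F i) j = forest_del (forest_del F (Suc j)) i"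
proof -
  obtain k a where a: "a \<in> qdes_tree (F k)" "i = a + offset F k"
    using assms(2) by (auto simp: Qdes_iff)
  define G where "G = F(k := del_tree a (F k))"
  have G: "forest_del F i = G" using a by (simp add: G_def forest_del_qdes)
  obtain l b where b: "b \<in> qdes_tree (G l)" "j = b + offset G l"
    using assms(3) by (auto simp: Qdes_iff G)
  have Gk: "offset G k = offset F k" by (simp add: G_def offset_upd_le)
  have "k \<le> l"
  proof (rule ccontr)
    assume "\<not> k \<le> l"
    then have "offset G (Suc l) \<le> offset G k" by (intro offset_mono) simp
    then show False using Suc_less_nleaves_if_qdes_tree[OF b(1)] b(2) a(2) assms(1) Gk by simp
  qed
  then consider "k = l" | "k < l" by linarith
  then show ?thesis
  proof cases
    case 1
    then have ab: "a < b" "b \<in> qdes_tree (del_tree a (F k))" and j: "j = b + offset F k"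
      using a b assms(1) Gk by (auto simp: G_def)
    note D = del_tree_commute[OF ab(1) a(1) ab(2)]
    define H where "H = F(k := del_tree (Suc b) (F k))"
    have Sj: "Suc j = Suc b + offset F k" using j by simp
    have H: "forest_del F (Suc j) = H" unfolding Sj using D by (simp add: H_def forest_del_qdes del: add_Suc)
    have Hk: "i = a + offset H k" using a by (simp add: H_def offset_upd_le)
    have aH: "a \<in> qdes_tree (H k)" using D by (simp add: H_def)
    have "forest_del G j = forest_del H i"
      unfolding b(2) forest_del_qdes[of b G l, OF b(1)] unfolding Hk forest_del_qdes[of a H k, OF aH]
      using D 1 by (simp add: G_def H_def)
    moreover have "Suc j \<in> Qdes F" using D Sj unfolding Qdes_iff by blast
    moreover have "i \<in> Qdes H" using aH Hk unfolding Qdes_iff by blast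
    ultimately show ?thesis unfolding G H by blast
  next
    case 2
    define H where "H = F(l := del_tree b (F l))"
    have bF: "b \<in> qdes_tree (F l)" using b 2 by (simp add: G_def)
    have Sj: "Suc j = b + offset F l"
      using b offset_upd_gt[of k l "del_tree a (F k)" F, OF 2 nleaves_del_tree[OF a(1)]] by (simp add: G_def)
    have H: "forest_del F (Suc j) = H" unfolding Sj using bF by (simp add: H_def forest_del_qdes)
    have Hk: "i = a + offset H k" using a 2 by (simp add: H_def offset_upd_le)
    have aH: "a \<in> qdes_tree (H k)" using a 2 by (simp add: H_def)
    have "forest_del G j = forest_del H i"
      unfolding b(2) forest_del_qdes[of b G l, OF b(1)] unfolding Hk forest_del_qdes[of a H k, OF aH]
      using 2 by (simp add: G_def H_def fun_upd_twist)
    moreover have "Suc j \<in> Qdes F" using bF Sj unfolding Qdes_iff by blast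
    moreover have "i \<in> Qdes H" using aH Hk unfolding Qdes_iff by blast
    ultimately show ?thesis unfolding G H by blast
  qed
qed

text \<open>With \<open>forest_del_commute\<close> this shows that both orders of contraction exist
  for the same pairs, so the prescribed second derivatives vanish together.\<close>

lemma Qdes_forest_del_commute:
  assumes "i < j" "Suc j \<in> Qdes F" "i \<in> Qdes (forest_del F (Suc j))"
  shows "i \<in> Qdes F \<and> j \<in> Qdes (forest_del F i)"
proof -
  obtain l b where b: "b \<in> qdes_tree (F l)" "Suc j = b + offset F l"
    using assms(2) by (auto simp: Qdes_iff)
  define H where "H = F(l := del_tree b (F l))"
  have H: "forest_del F (Suc j) = H" unfolding b(2) using b(1) by (simp add: H_def forest_del_qdes)
  obtain k a where a: "a \<in> qdes_tree (H k)" "i = a + offset H k"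
    using assms(3) by (auto simp: Qdes_iff H)
  note nb = nleaves_del_tree[OF b(1)] Suc_less_nleaves_if_qdes_tree[OF b(1)]
  have "k \<le> l"
  proof (rule ccontr)
    assume "\<not> k \<le> l"
    then have "offset H (Suc l) \<le> offset H k" by (intro offset_mono) simp
    moreover have "offset H l = offset F l" by (simp add: H_def offset_upd_le)
    ultimately show False using nb b(2) a(2) assms(1) by (simp add: H_def)
  qed
  then have i: "i = a + offset F k" using a(2) by (simp add: H_def offset_upd_le)
  consider "k = l" | "k < l" using \<open>k \<le> l\<close> by linarith
  then show ?thesis
  proof cases
    case 1
    then obtain c where c: "b = Suc c" "a < c" "j = c + offset F k"
      using i b(2) assms(1) by (cases b) auto
    have D: "a \<in> qdes_tree (F k)" "c \<in> qdes_tree (del_tree a (F k))"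
      using qdes_tree_del_tree_commute[of a c "F k"] a(1) b(1) c 1 by (simp_all add: H_def)
    then have "forest_del F i = F(k := del_tree a (F k))" by (simp add: i forest_del_qdes)
    moreover have "c \<in> qdes_tree ((F(k := del_tree a (F k))) k)" using D by simp
    moreover have "j = c + offset (F(k := del_tree a (F k))) k" using c by (simp add: offset_upd_le)
    ultimately show ?thesis using D(1) i unfolding Qdes_iff by metis
  next
    case 2
    then have aF: "a \<in> qdes_tree (F k)" using a(1) by (simp add: H_def)
    then have "forest_del F i = F(k := del_tree a (F k))" by (simp add: i forest_del_qdes)
    moreover have "b \<in> qdes_tree ((F(k := del_tree a (F k))) l)" using b 2 by simp
    moreover have "j = b + offset (F(k := del_tree a (F k))) l"
      using b offset_upd_gt[of k l "del_tree a (F k)" F, OF 2 nleaves_del_tree[OF aF]] by simp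
    ultimately show ?thesis using aF i unfolding Qdes_iff by metis
  qed
qed

text \<open>A binary tree with n leaves has n - 1 internal nodes, so for an indexed forest this
  counts internal nodes; it will be the degree of its polynomial.\<close>

definition forest_size :: "forest \<Rightarrow> nat" where
  "forest_size F = (\<Sum>k | F k \<noteq> Leaf. nleaves (F k) - 1)"

lemma indexed_forest_del: "indexed_forest F \<Longrightarrow> indexed_forest (forest_del F i)"
  unfolding indexed_forest_def
  by (erule rev_finite_subset) (auto simp: forest_del_def split: if_splits)

lemma forest_size_del:
  assumes "indexed_forest F" "i \<in> Qdes F"
  shows "Suc (forest_size (forest_del F i)) = forest_size F"
proof -
  obtain k a where a: "a \<in> qdes_tree (F k)" "i = a + offset F k"
    using assms(2) by (auto simp: Qdes_iff)
  define G where "G = F(k := del_tree a (F k))"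
  let ?K = "{k. F k \<noteq> Leaf}"
  have fin: "finite ?K" using assms(1) by (simp add: indexed_forest_def)
  have k: "k \<in> ?K" using a by auto
  \<comment> \<open>The contracted tree may become trivial; the old index set then only adds a zero
    term.\<close>
  have "forest_size G = (\<Sum>k\<in>?K. nleaves (G k) - 1)"
    unfolding forest_size_def by (rule sum.mono_neutral_left[OF fin]) (use k in \<open>auto simp: G_def\<close>)
  also have "\<dots> = (nleaves (del_tree a (F k)) - 1) + (\<Sum>k\<in>?K - {k}. nleaves (F k) - 1)"
    unfolding sum.remove[OF fin k] by (auto simp: G_def intro!: sum.cong)
  finally have "Suc (forest_size G) = Suc (nleaves (del_tree a (F k)) - 1) + (\<Sum>k\<in>?K - {k}. nleaves (F k) - 1)"
    by simp
  also have "Suc (nleaves (del_tree a (F k)) - 1) = nleaves (F k) - 1"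
    using nleaves_del_tree[OF a(1)] nleaves_pos[of "del_tree a (F k)"] by linarith
  also have "\<dots> + (\<Sum>k\<in>?K - {k}. nleaves (F k) - 1) = forest_size F"
    unfolding forest_size_def sum.remove[OF fin k] ..
  finally show ?thesis unfolding a(2) forest_del_qdes[of a F k, OF a(1)] G_def .
qed

lemma forest_size_eq_0_iff:
  assumes "indexed_forest F"
  shows "forest_size F = 0 \<longleftrightarrow> F = empty_forest"
proof -
  have "nleaves t - 1 \<noteq> 0" if "t \<noteq> Leaf" for t
    using that nleaves_eq_1_iff[of t] nleaves_pos[of t] by linarith
  then show ?thesis
    using assms by (auto simp: forest_size_def indexed_forest_def empty_forest_def fun_eq_iff)
qed

text \<open>Supplies the finiteness needed to integrate the prescribed derivatives.\<close>

lemma Qdes_bounded: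
  assumes "indexed_forest F"
  obtains n where "\<And>i. i \<in> Qdes F \<Longrightarrow> i < n"
proof -
  have "finite {k. F k \<noteq> Leaf}" using assms by (simp add: indexed_forest_def)
  then obtain K where K: "\<And>k. F k \<noteq> Leaf \<Longrightarrow> k < K"
    by (meson finite_nat_set_iff_bounded mem_Collect_eq)
  have "i < offset F K" if i: "i \<in> Qdes F" for i
  proof -
    obtain k a where a: "a \<in> qdes_tree (F k)" "i = a + offset F k"
      using i by (auto simp: Qdes_iff)
    then have "F k \<noteq> Leaf" by auto
    then have "offset F (Suc k) \<le> offset F K" using K by (intro offset_mono) (simp add: Suc_leI)
    then show ?thesis using a Suc_less_nleaves_if_qdes_tree[OF a(1)] by simp
  qed
  then show thesis using that by blast
qed

section \<open>Double forest polynomials\<close>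

text \<open>Recursive values are taken only at members of \<open>Qdes F\<close>, where
  \<open>forest_size\<close> drops. That a suitable f exists is shown in
  \<open>double_forest_poly_spec\<close>; 0 is a default outside indexed forests.\<close>

function double_forest_poly :: "forest \<Rightarrow> poly" where
  "double_forest_poly F = (if indexed_forest F
     then SOME f. hom (forest_size F) f \<and>
       ren diag_var f = (if F = empty_forest then 1 else 0) \<and>
       (\<forall>i. EE i i f = (if i \<in> Qdes F then ren (hat_var i) (double_forest_poly (forest_del F i)) else 0))
     else 0)"
  by auto
termination
  by (relation "measure forest_size") (use forest_size_del in fastforce)+

declare double_forest_poly.simps [simp del]

lemma Qdes_empty_forest [simp]: "Qdes empty_forest = {}"
  by (simp add: Qdes_def empty_forest_def)

text \<open>Both sides rename the letters t in order onto the alphabet without \<open>T i\<close>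
  and \<open>T (Suc j)\<close>.\<close>

lemma ren_hat_var_commute:
  "i < j \<Longrightarrow> ren (hat_var i) (ren (hat_var j) f) = ren (hat_var (Suc j)) (ren (hat_var i) f)"
  unfolding ren_ren by (rule ren_cong, rename_tac v, case_tac v) auto

lemma double_forest_poly_spec:
  assumes "indexed_forest F"
  shows "hom (forest_size F) (double_forest_poly F) \<and>
     ren diag_var (double_forest_poly F) = (if F = empty_forest then 1 else 0) \<and>
     (\<forall>i. EE i i (double_forest_poly F) = (if i \<in> Qdes F then ren (hat_var i) (double_forest_poly (forest_del F i)) else 0))"
  using assms
proof (induction "forest_size F" arbitrary: F rule: less_induct)
  case less
  have IH: "hom (forest_size (forest_del F i)) (double_forest_poly (forest_del F i))"
    "EE j j (double_forest_poly (forest_del F i)) = (if j \<in> Qdes (forest_del F i)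
      then ren (hat_var j) (double_forest_poly (forest_del (forest_del F i) j)) else 0)" if "i \<in> Qdes F" for i j
    using less.hyps[of "forest_del F i"] forest_size_del[OF less.prems that]
      indexed_forest_del[OF less.prems, of i] by auto
  define g where "g i = (if i \<in> Qdes F then ren (hat_var i) (double_forest_poly (forest_del F i)) else 0)" for i
  have "\<exists>f. hom (forest_size F) f \<and> ren diag_var f = (if F = empty_forest then 1 else 0) \<and>
       (\<forall>i. EE i i f = g i)"
  proof (cases "F = empty_forest")
    case True
    then have "forest_size F = 0" using less.prems by (simp add: forest_size_eq_0_iff)
    moreover have "EE i i 1 = 0" for i by (simp add: EE_eq_0_iff)
    ultimately show ?thesis using True by (intro exI[of _ 1]) (simp add: g_def)
  next
    case False
    then obtain d where d: "forest_size F = Suc d"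
      using less.prems by (metis forest_size_eq_0_iff not0_implies_Suc)
    obtain n where n: "\<And>i. i \<in> Qdes F \<Longrightarrow> i < n"
      using Qdes_bounded[OF less.prems] by blast
    have "\<exists>f. hom (Suc d) f \<and> (\<forall>i. EE i i f = g i)"
    proof (rule EE_integrable)
      show "g i = 0" if "i \<ge> n" for i
        using n[of i] that by (auto simp: g_def)
      show "hom d (g i)" for i
        using IH(1)[of i] forest_size_del[OF less.prems, of i] d
        by (auto simp: g_def intro!: hom_ren)
      show "EE j (Suc j) (g i) = EE i i (g (Suc j))" if ij: "i < j" for i j
      proof -
        \<comment> \<open>Since i < j, position j in the alphabet without t_i has letter
          \<open>T (Suc j)\<close>; below, position i in the alphabet without
          \<open>T (Suc j)\<close> keeps letter \<open>T i\<close>.\<close>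
        have 1: "EE j (Suc j) (g i) = (if i \<in> Qdes F \<and> j \<in> Qdes (forest_del F i)
          then ren (hat_var i) (ren (hat_var j) (double_forest_poly (forest_del (forest_del F i) j))) else 0)"
          using EE_ren_hat_var[of j i "double_forest_poly (forest_del F i)"] IH(2)[of i j] ij
          by (auto simp: g_def)
        have 2: "EE i i (g (Suc j)) = (if Suc j \<in> Qdes F \<and> i \<in> Qdes (forest_del F (Suc j))
          then ren (hat_var (Suc j)) (ren (hat_var i) (double_forest_poly (forest_del (forest_del F (Suc j)) i))) else 0)"
          using EE_ren_hat_var[of i "Suc j" "double_forest_poly (forest_del F (Suc j))"] IH(2)[of "Suc j" i] ij
          by (auto simp: g_def)
        show ?thesis
        proof (cases "i \<in> Qdes F \<and> j \<in> Qdes (forest_del F i)")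
          case True
          then show ?thesis
            unfolding 1 2 using forest_del_commute[OF ij] ren_hat_var_commute[OF ij] by simp
        next
          case False
          then show ?thesis unfolding 1 2 using Qdes_forest_del_commute[OF ij] by auto
        qed
      qed
    qed
    then obtain f where f: "hom (Suc d) f" "\<And>i. EE i i f = g i" by blast
    \<comment> \<open>Subtracting the value of f at x = t, which involves no x, makes that value 0
      without changing any derivative.\<close>
    have "X m \<notin> diag_var ` S" for m S
      by (auto elim: diag_var.elims[OF sym])
    then have "X m \<notin> vars (ren diag_var f)" for m
      using vars_ren[of diag_var f] by blast
    then have "EE i i (ren diag_var f) = 0" for i
      by (intro EE_eq_0_if_vars) blast
    then have "EE i i (f - ren diag_var f) = g i" for i
      by (simp add: EE_diff f(2))
    moreover have "ren diag_var (ren diag_var f) = ren diag_var f"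
      unfolding ren_ren by (rule ren_cong, rename_tac v, case_tac v) auto
    ultimately show ?thesis
      using f(1) False d by (intro exI[of _ "f - ren diag_var f"]) (simp add: hom_diff hom_ren ren_diff)
  qed
  note ex = this
  have eq: "double_forest_poly F =
      (SOME f. hom (forest_size F) f \<and> ren diag_var f = (if F = empty_forest then 1 else 0) \<and>
        (\<forall>i. EE i i f = g i))"
    unfolding double_forest_poly.simps[of F] g_def if_P[OF less.prems] ..
  have "hom (forest_size F) (double_forest_poly F) \<and>
      ren diag_var (double_forest_poly F) = (if F = empty_forest then 1 else 0) \<and>
      (\<forall>i. EE i i (double_forest_poly F) = g i)"
    unfolding eq by (rule someI_ex[OF ex])
  then show ?case unfolding g_def .
qed

text \<open>f - g is killed by all \<open>EE i i\<close>, so it has no x and equals its own value at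
  x = t, which is 0.\<close>

lemma eq_if_EE_eq:
  assumes "\<And>i. EE i i f = EE i i g" and "ren diag_var f = ren diag_var g"
  shows "f = g"
proof -
  have no_X: "X m \<notin> vars (f - g)" for m
    using no_X_vars_if_EE_eq_0[of 0 "\<lambda>j. j" "f - g" m] assms(1) by (auto simp: EE_diff)
  have "ren diag_var (f - g) = f - g"
    by (rule ren_cong_id, rename_tac v, case_tac v) (use no_X in auto)
  then show ?thesis using assms(2) by (simp add: ren_diff)
qed

theorem theorem4p2:
  shows "\<exists>P :: forest \<Rightarrow> poly.
    (\<forall>F. indexed_forest F \<longrightarrow>
        homogeneous (P F) \<and>
        subst at_t (P F) = (if F = empty_forest then 1 else 0) \<and>
        (\<forall>i. E i (P F) = (if i \<in> Qdes F then subst (hat_t i) (P (forest_del F i)) else 0))) \<and>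
    (\<forall>Q :: forest \<Rightarrow> poly.
      (\<forall>F. indexed_forest F \<longrightarrow>
        homogeneous (Q F) \<and>
        subst at_t (Q F) = (if F = empty_forest then 1 else 0) \<and>
        (\<forall>i. E i (Q F) = (if i \<in> Qdes F then subst (hat_t i) (Q (forest_del F i)) else 0)))
      \<longrightarrow> (\<forall>F. indexed_forest F \<longrightarrow> Q F = P F))"
  unfolding subst_at_t subst_hat_t E_eq_EE
proof (intro exI[of _ double_forest_poly] conjI allI impI)
  fix F :: forest assume F: "indexed_forest F"
  show "homogeneous (double_forest_poly F)"
    using double_forest_poly_spec[OF F] homogeneous_if_hom by blast
  show "ren diag_var (double_forest_poly F) = (if F = empty_forest then 1 else 0)"
    using double_forest_poly_spec[OF F] by blast
  show "EE i i (double_forest_poly F) = (if i \<in> Qdes F then ren (hat_var i) (double_forest_poly (forest_del F i)) else 0)" for i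
    using double_forest_poly_spec[OF F] by blast
next
  fix Q :: "forest \<Rightarrow> poly" and F :: forest
  assume Q: "\<forall>F. indexed_forest F \<longrightarrow> homogeneous (Q F) \<and>
      ren diag_var (Q F) = (if F = empty_forest then 1 else 0) \<and>
      (\<forall>i. EE i i (Q F) = (if i \<in> Qdes F then ren (hat_var i) (Q (forest_del F i)) else 0))"
  assume "indexed_forest F"
  then show "Q F = double_forest_poly F"
  \<comment> \<open>Contractions of F are smaller, so by induction both polynomials have the same
    derivatives, and their values at x = t agree.\<close>
  proof (induction "forest_size F" arbitrary: F rule: less_induct)
    case less
    have eq: "Q (forest_del F i) = double_forest_poly (forest_del F i)" if "i \<in> Qdes F" for i
      using less.hyps[of "forest_del F i"] forest_size_del[OF less.prems that]
        indexed_forest_del[OF less.prems, of i] by simp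
    have QF: "ren diag_var (Q F) = (if F = empty_forest then 1 else 0)"
      "EE i i (Q F) = (if i \<in> Qdes F then ren (hat_var i) (Q (forest_del F i)) else 0)" for i
      using Q less.prems by blast+
    show ?case
    proof (rule eq_if_EE_eq)
      show "EE i i (Q F) = EE i i (double_forest_poly F)" for i
        using QF(2)[of i] double_forest_poly_spec[OF less.prems] eq[of i] by presburger
      show "ren diag_var (Q F) = ren diag_var (double_forest_poly F)"
        using QF(1) double_forest_poly_spec[OF less.prems] by presburger
    qed
  qed
qed

end
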